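(* If $G$ is a $2$-connected bipartite graph, then $$\alpha_{\mathrm{bn}}(G)=\alpha_{\mathrm{bnr}}(G)=\alpha_{\mathrm{bnd}}(G)=\alpha(G),$$ where $\alpha(G)$ is the independence number of $G$.
   Context: Graphs are finite and simple; $d$ is graph distance and $e(v)$ is the eccentricity of $v$. A broadcast on a nontrivial connected graph $G=(V,E)$ is a function $f:V\to\{0,1,\dots,\operatorname{diam}(G)\}$ with $f(v)\le e(v)$ for all $v\in V$. Its weight is $\sigma(f)=\sum_{v\in V}f(v)$. Let $V_f^+=\{v\in V: f(v)>0\}$ (the broadcasting vertices). A vertex $u$ hears $f$ from $v\in V_f^+$ if $d(u,v)\le f(v)$ (so a broadcasting vertex hears itself). Put $N_f(v)=\{u\in V:d(u,v)\le f(v)\}$. The broadcast $f$ is dominating if every vertex hears $f$ from at least one vertex of $V_f^+$. For $v\in V_f^+$, the private boundary $\operatorname{PB}_f(v)$ is the set of all $u\in N_f(v)$ that do not hear the broadcast obtained from $f$ by replacing the value $f(v)$ by $f(v)-1$ (all other values unchanged) from any of its broadcasting vertices. A broadcast $f$ is bn-independent (boundary independent) if it overlaps only in boundaries: whenever a vertex $x$ hears $f$ from more than one vertex of $V_f^+$, then $d(x,u)\ge f(u)$ for all $u\in V_f^+$ (equivalently, $d(x,u)=f(u)$ for every $u\in V_f^+$ from which $x$ hears $f$). A broadcast $f$ is bnr-independent if it is bn-independent and irredundant, i.e. $\operatorname{PB}_f(v)\ne\varnothing$ for every $v\in V_f^+$. A broadcast $f$ is bnd-independent if it is bn-independent and minimal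 dominating, i.e. dominating and no broadcast $g\neq f$ with $g(v)\le f(v)$ for all $v$ is dominating. The numbers $\alpha_{\mathrm{bn}}(G)$, $\alpha_{\mathrm{bnr}}(G)$, $\alpha_{\mathrm{bnd}}(G)$ are the maximum weights of a bn-, bnr-, bnd-independent broadcast on $G$, respectively. *)

theory Defs
  imports "Graph_Theory.Graph_Theory" "HOL-Library.FuncSet"
begin

text \<open>
  Finite simple graphs are the library's \<open>graph\<close>s, that is, finite symmetric digraphs without
  loops and parallel arcs; \<open>u \<rightarrow>\<^bsub>G\<^esub> v\<close> is adjacency. Names such as \<open>graph\<close> and \<open>connected\<close> are
  qualified where they collide with constants of HOL.
\<close>

section \<open>Graphs\<close>

text \<open>
  Diestel's convention: more than \<open>k\<close> vertices, and no set of fewer than \<open>k\<close> vertices separates.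
  In particular \<open>K\<^sub>2\<close> is not 2-connected, and a 2-connected graph is connected.
\<close>

definition k_connected :: "nat \<Rightarrow> ('a, 'b) pre_digraph \<Rightarrow> bool" where
  "k_connected k G \<longleftrightarrow> k < card (verts G) \<and>
     (\<forall>X \<subseteq> verts G. card X < k \<longrightarrow> Digraph_Component.connected (G \<restriction> (verts G - X)))"

definition bipartite :: "('a, 'b) pre_digraph \<Rightarrow> bool" where
  "bipartite G \<longleftrightarrow> (\<exists>A B. A \<union> B = verts G \<and> A \<inter> B = {} \<and>
     (\<forall>u v. u \<rightarrow>\<^bsub>G\<^esub> v \<longrightarrow> u \<in> A \<and> v \<in> B \<or> u \<in> B \<and> v \<in> A))"

definition independent_set :: "('a, 'b) pre_digraph \<Rightarrow> 'a set \<Rightarrow> bool" where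
  "independent_set G S \<longleftrightarrow> S \<subseteq> verts G \<and> (\<forall>u \<in> S. \<forall>v \<in> S. \<not> u \<rightarrow>\<^bsub>G\<^esub> v)"

definition independence_number :: "('a, 'b) pre_digraph \<Rightarrow> nat" where
  "independence_number G = Max (card ` {S. independent_set G S})"

text \<open>Only meaningful when \<open>v\<close> is reachable from \<open>u\<close>.\<close>

definition gdist :: "('a, 'b) pre_digraph \<Rightarrow> 'a \<Rightarrow> 'a \<Rightarrow> nat" where
  "gdist G u v = (LEAST n. \<exists>p. pre_digraph.awalk G u p v \<and> length p = n)"

lemma (in wf_digraph) awalk_cost_unit: "awalk_cost (\<lambda>_. 1) p = real (length p)"
  by (induction p) auto

lemma (in wf_digraph) gdist_eq_mu:
  assumes "u \<rightarrow>\<^sup>* v"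
  shows "ereal (real (gdist G u v)) = \<mu> (\<lambda>_. 1) u v"
proof -
  obtain p where p: "awalk u p v" "length p = gdist G u v"
    using assms LeastI_ex[of "\<lambda>n. \<exists>p. awalk u p v \<and> length p = n"]
    unfolding gdist_def reachable_awalk by blast
  have "gdist G u v \<le> length q" if "awalk u q v" for q
    unfolding gdist_def using that by (blast intro: Least_le)
  then have "ereal (real (gdist G u v)) \<le> \<mu> (\<lambda>_. 1) u v"
    unfolding \<mu>_def by (auto intro!: INF_greatest simp: awalk_cost_unit)
  moreover have "\<mu> (\<lambda>_. 1) u v \<le> ereal (real (gdist G u v))"
    using min_cost_le_walk_cost[OF p(1), of "\<lambda>_. 1"] p(2) by (simp add: awalk_cost_unit)
  ultimately show ?thesis
    by (rule antisym)
qed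

definition eccentricity :: "('a, 'b) pre_digraph \<Rightarrow> 'a \<Rightarrow> nat" where
  "eccentricity G v = Max (gdist G v ` verts G)"

definition diam :: "('a, 'b) pre_digraph \<Rightarrow> nat" where
  "diam G = Max (eccentricity G ` verts G)"


section \<open>Broadcasts\<close>

text \<open>
  Broadcasts are extensional functions, so that two broadcasts are equal as soon as they agree
  on the vertices of the graph.
\<close>

definition broadcasts :: "('a, 'b) pre_digraph \<Rightarrow> ('a \<Rightarrow> nat) set" where
  "broadcasts G =
     {f \<in> verts G \<rightarrow>\<^sub>E {0..diam G}. \<forall>v \<in> verts G. f v \<le> eccentricity G v}"

definition weight :: "('a, 'b) pre_digraph \<Rightarrow> ('a \<Rightarrow> nat) \<Rightarrow> nat" where
  "weight G f = (\<Sum>v \<in> verts G. f v)"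

definition broadcasting :: "('a, 'b) pre_digraph \<Rightarrow> ('a \<Rightarrow> nat) \<Rightarrow> 'a set" where
  "broadcasting G f = {v \<in> verts G. f v > 0}"

definition hears :: "('a, 'b) pre_digraph \<Rightarrow> ('a \<Rightarrow> nat) \<Rightarrow> 'a \<Rightarrow> 'a \<Rightarrow> bool" where
  "hears G f u v \<longleftrightarrow> v \<in> broadcasting G f \<and> gdist G u v \<le> f v"

definition nbhd :: "('a, 'b) pre_digraph \<Rightarrow> ('a \<Rightarrow> nat) \<Rightarrow> 'a \<Rightarrow> 'a set" where
  "nbhd G f v = {u \<in> verts G. gdist G u v \<le> f v}"

definition dominating :: "('a, 'b) pre_digraph \<Rightarrow> ('a \<Rightarrow> nat) \<Rightarrow> bool" where
  "dominating G f \<longleftrightarrow> (\<forall>u \<in> verts G. \<exists>v \<in> broadcasting G f. hears G f u v)"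

definition minimal_dominating :: "('a, 'b) pre_digraph \<Rightarrow> ('a \<Rightarrow> nat) \<Rightarrow> bool" where
  "minimal_dominating G f \<longleftrightarrow> dominating G f \<and>
     \<not> (\<exists>g \<in> broadcasts G. g \<noteq> f \<and> (\<forall>v \<in> verts G. g v \<le> f v) \<and> dominating G g)"

definition private_boundary :: "('a, 'b) pre_digraph \<Rightarrow> ('a \<Rightarrow> nat) \<Rightarrow> 'a \<Rightarrow> 'a set" where
  "private_boundary G f v = {u \<in> nbhd G f v.
     \<not> (\<exists>w \<in> broadcasting G (f(v := f v - 1)). hears G (f(v := f v - 1)) u w)}"

definition irredundant :: "('a, 'b) pre_digraph \<Rightarrow> ('a \<Rightarrow> nat) \<Rightarrow> bool" where
  "irredundant G f \<longleftrightarrow> (\<forall>v \<in> broadcasting G f. private_boundary G f v \<noteq> {})"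

definition bn_independent :: "('a, 'b) pre_digraph \<Rightarrow> ('a \<Rightarrow> nat) \<Rightarrow> bool" where
  "bn_independent G f \<longleftrightarrow> (\<forall>x \<in> verts G. card {v \<in> broadcasting G f. hears G f x v} > 1 \<longrightarrow>
     (\<forall>u \<in> broadcasting G f. gdist G x u \<ge> f u))"

definition bnr_independent :: "('a, 'b) pre_digraph \<Rightarrow> ('a \<Rightarrow> nat) \<Rightarrow> bool" where
  "bnr_independent G f \<longleftrightarrow> bn_independent G f \<and> irredundant G f"

definition bnd_independent :: "('a, 'b) pre_digraph \<Rightarrow> ('a \<Rightarrow> nat) \<Rightarrow> bool" where
  "bnd_independent G f \<longleftrightarrow> bn_independent G f \<and> minimal_dominating G f"

definition alpha_bn :: "('a, 'b) pre_digraph \<Rightarrow> nat" where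
  "alpha_bn G = Max (weight G ` {f \<in> broadcasts G. bn_independent G f})"

definition alpha_bnr :: "('a, 'b) pre_digraph \<Rightarrow> nat" where
  "alpha_bnr G = Max (weight G ` {f \<in> broadcasts G. bnr_independent G f})"

definition alpha_bnd :: "('a, 'b) pre_digraph \<Rightarrow> nat" where
  "alpha_bnd G = Max (weight G ` {f \<in> broadcasts G. bnd_independent G f})"

end

(*
  Upper bound: in a bn-independent broadcast f, the open balls {u. d(u,v) < f(v)} around the
  broadcasting vertices v are disjoint, and no edge joins two of them. Hence it suffices to find
  an independent set of size f(v) in each open ball. In a bipartite graph, the distance levels
  around v whose index has the parity of f(v) - 1 have an independent union, and in a 2-connected
  graph each level strictly between 0 and the eccentricity has at least two vertices, as a
  one-vertex level would separate v from the vertices farther away.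

  Lower bound: the indicator function of a maximum independent set is bn-independent, irredundant
  and minimal dominating.
*)
theory Submission
  imports Defs
begin

section \<open>Connectedness, distance and walk parity\<close>

text \<open>A walk inside \<open>V\<close> that starts in \<open>C\<close> can never leave
  \<open>C\<close>. This is the form in which connectedness is used: \<open>C\<close> is a set of
  reachable vertices or an open ball, and \<open>V\<close> is what remains after deleting a
  level.\<close>

lemma connected_induce_closed:
  assumes "Digraph_Component.connected (G \<restriction> V)" "symmetric G"
    and "x \<in> V" "x \<in> C"
    and closed: "\<And>y z. y \<in> C \<Longrightarrow> z \<in> V \<Longrightarrow> y \<rightarrow>\<^bsub>G\<^esub> z \<Longrightarrow> z \<in> C"
  shows "V \<subseteq> C"
proof
  fix w assume "w \<in> V"
  then have "(x, w) \<in> rtrancl_on V ((arcs_ends (G \<restriction> V))\<^sup>s)"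
    using assms(1,3) by (auto simp: connected_conv)
  then show "w \<in> C"
  proof (induction rule: rtrancl_on_induct)
    case base
    show ?case using assms(4) .
  next
    case (step y z)
    \<comment> \<open>The chain runs in the symmetric closure of the induced arcs; symmetry of
      \<open>G\<close> turns each of its steps into an arc of \<open>G\<close>.\<close>
    have "y \<rightarrow>\<^bsub>G\<^esub> z"
      using step.hyps(2) assms(2)
      by (auto simp: symcl_def dest: dominates_induce_subgraphD arcs_ends_symmetric)
    then show ?case using closed step by blast
  qed
qed

context wf_digraph
begin

lemma gdist_awalk:
  assumes "u \<rightarrow>\<^sup>* v"
  obtains p where "awalk u p v" "length p = gdist G u v"
  using assms LeastI_ex[of "\<lambda>n. \<exists>p. awalk u p v \<and> length p = n"]
  unfolding gdist_def reachable_awalk by blast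

lemma gdist_le_length: "awalk u p v \<Longrightarrow> gdist G u v \<le> length p"
  unfolding gdist_def by (blast intro: Least_le)

lemma gdist_self [simp]: "v \<in> verts G \<Longrightarrow> gdist G v v = 0"
  using gdist_le_length[of v "[]" v] by (simp add: awalk_Nil_iff)

lemma gdist_eq_0_iff: "u \<rightarrow>\<^sup>* v \<Longrightarrow> gdist G u v = 0 \<longleftrightarrow> u = v"
  by (metis gdist_awalk gdist_self awalk_Nil_iff length_0_conv reachable_in_verts(1))

lemma gdist_adj_le:
  assumes "u \<rightarrow> w" "w \<rightarrow>\<^sup>* v"
  shows "gdist G u v \<le> Suc (gdist G w v)"
proof -
  obtain p where p: "awalk w p v" "length p = gdist G w v"
    using assms(2) by (rule gdist_awalk)
  obtain e where "e \<in> arcs G" "tail G e = u" "head G e = w"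
    using assms(1) by auto
  then have "awalk u (e # p) v"
    using p by (simp add: awalk_Cons_iff)
  then show ?thesis
    using gdist_le_length[of u "e # p" v] p(2) by simp
qed

end

lemma (in sym_digraph) awalk_reverse:
  assumes "awalk u p v"
  shows "\<exists>q. awalk v q u \<and> length q = length p"
  using assms
proof (induction p arbitrary: u)
  case Nil
  then show ?case by (auto simp: awalk_Nil_iff)
next
  case (Cons e p)
  then have e: "e \<in> arcs G" "tail G e = u" and "awalk (head G e) p v"
    by (auto simp: awalk_Cons_iff)
  then obtain q where q: "awalk v q (head G e)" "length q = length p"
    using Cons.IH by blast
  obtain e' where e': "e' \<in> arcs G" "tail G e' = head G e" "head G e' = u"
    using e sym_arcs unfolding symmetric_conv by metis
  then have "awalk (head G e) [e'] u"
    by (auto simp: awalk_simps)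
  with q have "awalk v (q @ [e']) u"
    by (blast intro: awalk_appendI)
  then show ?case
    using q(2) by (intro exI[of _ "q @ [e']"]) simp
qed

lemma (in sym_digraph) gdist_commute: "gdist G u v = gdist G v u"
  unfolding gdist_def using awalk_reverse by metis

text \<open>Each arc switches sides, so the parity of a walk depends only on its ends.\<close>

lemma (in wf_digraph) even_length_awalk_bipartite:
  assumes "awalk u p v" "A \<inter> B = {}"
    and "\<And>u v. u \<rightarrow> v \<Longrightarrow> u \<in> A \<and> v \<in> B \<or> u \<in> B \<and> v \<in> A"
  shows "even (length p) \<longleftrightarrow> (u \<in> A \<longleftrightarrow> v \<in> A)"
  using assms(1)
proof (induction p arbitrary: u)
  case Nil
  then show ?case by (simp add: awalk_Nil_iff)
next
  case (Cons e p)
  then have "u \<rightarrow> head G e" "awalk (head G e) p v"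
    by (auto simp: awalk_Cons_iff in_arcs_imp_in_arcs_ends)
  then show ?case
    using Cons.IH assms(2) assms(3)[of u "head G e"] by auto
qed

section \<open>Distance levels in a 2-connected bipartite graph\<close>

locale two_connected_bipartite = Digraph.graph +
  assumes two_connected: "k_connected 2 G"
    and bipartite: "bipartite G"
begin

lemma connected_remove: "X \<subseteq> verts G \<Longrightarrow> card X < 2 \<Longrightarrow> Digraph_Component.connected (G \<restriction> (verts G - X))"
  using two_connected unfolding k_connected_def by blast

lemma verts_reachable:
  assumes "u \<in> verts G" "v \<in> verts G"
  shows "u \<rightarrow>\<^sup>* v"
proof -
  have "verts G \<subseteq> {w. u \<rightarrow>\<^sup>* w}"
    using connected_remove[of "{}"] assms(1)
    by (intro connected_induce_closed[of G "verts G" u]) (auto intro: reachable_adj_trans)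
  then show ?thesis using assms(2) by blast
qed

text \<open>The parity of the distance to \<open>v\<close> tells on which side of the bipartition a
  vertex lies, and adjacent vertices lie on opposite sides.\<close>

lemma gdist_parity_adj:
  assumes "x \<rightarrow> y" "v \<in> verts G"
  shows "even (gdist G x v) \<noteq> even (gdist G y v)"
proof -
  obtain A B where AB: "A \<inter> B = {}" "\<And>u v. u \<rightarrow> v \<Longrightarrow> u \<in> A \<and> v \<in> B \<or> u \<in> B \<and> v \<in> A"
    using bipartite unfolding bipartite_def by blast
  have "even (gdist G u v) \<longleftrightarrow> (u \<in> A \<longleftrightarrow> v \<in> A)" if "u \<in> verts G" for u
    using gdist_awalk[OF verts_reachable[OF that assms(2)]] even_length_awalk_bipartite AB by metis
  then show ?thesis
    using AB assms(1) adj_in_verts[OF assms(1)] by blast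
qed

text \<open>Deleting a level of at most one vertex keeps the graph connected. But distances to
  \<open>v\<close> grow by at most one along an edge, so without level \<open>i\<close> no walk from
  \<open>v\<close> leaves the open ball of radius \<open>i\<close>, whereas \<open>z\<close> lies
  beyond it.\<close>

lemma card_level_ge_2:
  assumes "v \<in> verts G" "z \<in> verts G" "0 < i" "i < gdist G z v"
  shows "2 \<le> card {u \<in> verts G. gdist G u v = i}"
proof (rule ccontr)
  define X where "X = {u \<in> verts G. gdist G u v = i}"
  assume "\<not> ?thesis"
  then have conn: "Digraph_Component.connected (G \<restriction> (verts G - X))"
    by (intro connected_remove) (auto simp: X_def)
  have "w \<in> {u. gdist G u v < i}"
    if y: "y \<in> {u. gdist G u v < i}" and w: "w \<in> verts G - X" and yw: "y \<rightarrow> w" for y w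
  proof -
    have "w \<rightarrow> y"
      using yw sym_arcs arcs_ends_symmetric by metis
    then have "gdist G w v \<le> Suc (gdist G y v)"
      using assms(1) adj_in_verts(1)[OF yw] by (blast intro: gdist_adj_le verts_reachable)
    then show ?thesis
      using y w by (auto simp: X_def)
  qed
  then have "verts G - X \<subseteq> {u. gdist G u v < i}"
    using conn sym_arcs assms(1,3) by (intro connected_induce_closed[of G _ v]) (auto simp: X_def)
  then show False
    using assms(2,4) by (auto simp: X_def)
qed

text \<open>The levels \<open>k - 1\<close>, \<open>k - 3\<close>, ... around \<open>v\<close>:
  every other level of the open ball of radius \<open>k\<close>, starting with the
  outermost.\<close>

definition alternate_levels :: "'a \<Rightarrow> nat \<Rightarrow> 'a set" where
  "alternate_levels v k = {u \<in> verts G. gdist G u v < k \<and> odd (gdist G u v + k)}"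

lemma alternate_levels_independent:
  "v \<in> verts G \<Longrightarrow> x \<in> alternate_levels v k \<Longrightarrow> y \<in> alternate_levels v k \<Longrightarrow> \<not> x \<rightarrow> y"
  using gdist_parity_adj[of x y v] by (auto simp: alternate_levels_def)

text \<open>Induction in steps of two: from \<open>k\<close> to \<open>k + 2\<close> the level
  \<open>k + 1\<close> is added, which lies strictly between \<open>v\<close> and \<open>z\<close>
  and so has at least two vertices. For \<open>k = 1\<close> the level is
  \<open>{v}\<close>.\<close>

lemma card_alternate_levels_ge:
  assumes "v \<in> verts G" "z \<in> verts G" "k \<le> gdist G z v"
  shows "k \<le> card (alternate_levels v k)"
  using assms(3)
proof (induction k rule: nat_induct2)
  case 0
  show ?case by simp
next
  case 1
  have "{v} \<subseteq> alternate_levels v 1" "finite (alternate_levels v 1)"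
    using assms(1) by (auto simp: alternate_levels_def)
  then show ?case
    using card_mono[of "alternate_levels v 1" "{v}"] by simp
next
  case (step k)
  let ?L = "{u \<in> verts G. gdist G u v = Suc k}"
  have "k + 2 \<le> card (alternate_levels v k) + card ?L"
    using step card_level_ge_2[OF assms(1,2), of "Suc k"] by simp
  also have "\<dots> = card (alternate_levels v k \<union> ?L)"
    by (intro card_Un_disjoint[symmetric]) (auto simp: alternate_levels_def)
  also have "\<dots> \<le> card (alternate_levels v (k + 2))"
    by (intro card_mono) (auto simp: alternate_levels_def)
  finally show ?case .
qed

section \<open>Upper bound on the weight\<close>

lemma finite_independent_sets: "finite {S. independent_set G S}"
  by (rule finite_subset[of _ "Pow (verts G)"]) (auto simp: independent_set_def)

lemma card_le_independence_number: "independent_set G S \<Longrightarrow> card S \<le> independence_number G"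
  unfolding independence_number_def using finite_independent_sets by (auto intro!: Max_ge)

text \<open>Otherwise \<open>x\<close> would hear two vertices while lying strictly inside the ball
  of \<open>u\<close>. Only the bound for \<open>u\<close> is strict; this asymmetry later excludes
  edges between different open balls as well as common vertices.\<close>

lemma bn_independent_interior:
  assumes "bn_independent G f" "x \<in> verts G"
    and "u \<in> broadcasting G f" "v \<in> broadcasting G f"
    and "gdist G x u < f u" "gdist G x v \<le> f v"
  shows "u = v"
proof (rule ccontr)
  let ?H = "{w \<in> broadcasting G f. hears G f x w}"
  assume "u \<noteq> v"
  moreover have "{u, v} \<subseteq> ?H" "finite ?H"
    using assms by (auto simp: hears_def broadcasting_def)
  ultimately have "card ?H > 1"
    using card_mono[of ?H "{u, v}"] by simp
  then show False
    using assms(1,2,3,5) unfolding bn_independent_def by force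
qed

lemma bn_independent_weight_le:
  assumes f: "f \<in> broadcasts G" and bn: "bn_independent G f"
  shows "weight G f \<le> independence_number G"
proof -
  let ?B = "broadcasting G f" and ?I = "\<lambda>v. alternate_levels v (f v)"
  have fin: "finite ?B" and B: "?B \<subseteq> verts G"
    by (auto simp: broadcasting_def)
  have I: "x \<in> verts G" "gdist G x v < f v" if "x \<in> ?I v" for x v
    using that by (auto simp: alternate_levels_def)
  have le: "f v \<le> card (?I v)" if v: "v \<in> verts G" for v
  proof -
    \<comment> \<open>A vertex \<open>z\<close> farthest from \<open>v\<close> has distance at least
      \<open>f v\<close>, as the count of alternate levels requires.\<close>
    have "eccentricity G v \<in> gdist G v ` verts G"
      unfolding eccentricity_def using v by (intro Max_in) auto
    then obtain z where "z \<in> verts G" "f v \<le> gdist G v z"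
      using f v unfolding broadcasts_def by force
    then show ?thesis
      using card_alternate_levels_ge v gdist_commute by metis
  qed
  have disj: "?I u \<inter> ?I v = {}" if "u \<in> ?B" "v \<in> ?B" "u \<noteq> v" for u v
    using that bn_independent_interior[OF bn I(1) _ _ I(2) less_imp_le[OF I(2)]] by blast
  have indep: "\<not> x \<rightarrow> y"
    if "u \<in> ?B" "v \<in> ?B" "x \<in> ?I u" "y \<in> ?I v" for u v x y
  proof
    assume xy: "x \<rightarrow> y"
    \<comment> \<open>A neighbour of the open ball of \<open>v\<close> lies in its closed ball. As
      \<open>x\<close> is also strictly inside the ball of \<open>u\<close>, both centres agree, and
      the edge would join two alternate levels of one centre.\<close>
    have "gdist G x v \<le> Suc (gdist G y v)"
      using xy I(1)[OF that(4)] that(2) B by (intro gdist_adj_le verts_reachable) auto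
    then have "gdist G x v \<le> f v"
      using I(2)[OF that(4)] by simp
    then have "u = v"
      using bn_independent_interior[OF bn I(1)[OF that(3)] that(1,2) I(2)[OF that(3)]] by blast
    then show False
      using alternate_levels_independent xy that B by blast
  qed
  have "weight G f = (\<Sum>v\<in>?B. f v)"
    unfolding weight_def by (rule sum.mono_neutral_right) (auto simp: broadcasting_def)
  also have "\<dots> \<le> (\<Sum>v\<in>?B. card (?I v))"
    using le B by (auto intro!: sum_mono)
  also have "\<dots> = card (\<Union>v\<in>?B. ?I v)"
    using fin disj by (intro card_UN_disjoint[symmetric]) (auto simp: alternate_levels_def)
  also have "\<dots> \<le> independence_number G"
    using indep I(1) by (intro card_le_independence_number) (auto simp: independent_set_def)
  finally show ?thesis .
qed

section \<open>Indicator functions of independent sets\<close>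

text \<open>Restricted to \<open>verts G\<close> because broadcasts are extensional.\<close>

definition indicator_broadcast :: "'a set \<Rightarrow> 'a \<Rightarrow> nat" where
  "indicator_broadcast S = (\<lambda>v\<in>verts G. of_bool (v \<in> S))"

lemma broadcasting_indicator: "S \<subseteq> verts G \<Longrightarrow> broadcasting G (indicator_broadcast S) = S"
  by (auto simp: broadcasting_def indicator_broadcast_def)

lemma indicator_broadcast_in_broadcasts: "indicator_broadcast S \<in> broadcasts G"
proof -
  have ecc: "1 \<le> eccentricity G v" if v: "v \<in> verts G" for v
  proof -
    have "1 < card (verts G)"
      using two_connected by (simp add: k_connected_def)
    then obtain u where u: "u \<in> verts G" "u \<noteq> v"
      by (metis card_le_Suc0_iff_eq finite_verts linorder_not_less One_nat_def)
    then have "1 \<le> gdist G v u"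
      using v gdist_eq_0_iff[OF verts_reachable] by (metis One_nat_def Suc_leI neq0_conv)
    also have "\<dots> \<le> eccentricity G v"
      unfolding eccentricity_def using u by (intro Max_ge) auto
    finally show ?thesis .
  qed
  moreover have "1 \<le> diam G" if v: "v \<in> verts G" for v
  proof -
    have "eccentricity G v \<le> diam G"
      unfolding diam_def using v by (intro Max_ge) auto
    then show ?thesis using ecc[OF v] by simp
  qed
  ultimately show ?thesis
    by (auto simp: broadcasts_def indicator_broadcast_def)
qed

lemma gdist_le_1:
  assumes "u \<in> verts G" "v \<in> verts G" "gdist G u v \<le> 1"
  shows "u = v \<or> u \<rightarrow> v"
proof -
  obtain p where p: "awalk u p v" "length p \<le> 1"
    using gdist_awalk[OF verts_reachable[OF assms(1,2)]] assms(3) by metis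
  then show ?thesis
    by (cases p) (auto simp: awalk_simps in_arcs_imp_in_arcs_ends)
qed

lemma gdist_adj_le_1: "u \<rightarrow> v \<Longrightarrow> gdist G u v \<le> 1"
  using gdist_adj_le[of u v v] by (simp add: adj_in_verts verts_reachable)

lemma independent_gdist_le_1:
  assumes "independent_set G S" "u \<in> S" "v \<in> S" "gdist G u v \<le> 1"
  shows "u = v"
  using assms gdist_le_1[of u v] by (auto simp: independent_set_def)

text \<open>Vertices of \<open>S\<close> are at distance at least 2 from each other, so each hears
  only itself. A vertex hearing two of them is thus outside \<open>S\<close>, at distance at least
  1, the broadcast value, from all of \<open>S\<close>.\<close>

lemma indicator_bn_independent:
  assumes S: "independent_set G S"
  shows "bn_independent G (indicator_broadcast S)"
  unfolding bn_independent_def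
proof (intro ballI impI)
  have sub: "S \<subseteq> verts G" using S by (simp add: independent_set_def)
  note B = broadcasting_indicator[OF sub]
  have one: "indicator_broadcast S v = 1" if "v \<in> S" for v
    using that sub by (auto simp: indicator_broadcast_def)
  fix x u
  let ?H = "{v \<in> broadcasting G (indicator_broadcast S). hears G (indicator_broadcast S) x v}"
  assume x: "x \<in> verts G" and H: "1 < card ?H"
    and u: "u \<in> broadcasting G (indicator_broadcast S)"
  have "x \<notin> S"
  proof
    assume "x \<in> S"
    then have "?H \<subseteq> {x}"
      using independent_gdist_le_1[OF S, of x, symmetric] one by (auto simp: B hears_def)
    then show False
      using H card_mono[of "{x}" ?H] by simp
  qed
  then have "0 < gdist G x u"
    using u x sub gdist_eq_0_iff[OF verts_reachable, of x u] by (auto simp: B)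
  then show "indicator_broadcast S u \<le> gdist G x u"
    using u one by (simp add: B)
qed

text \<open>
  If the value at \<open>v\<close> is reduced to \<open>0\<close>, then \<open>v\<close> itself no longer hears anything. This gives
  irredundance and minimality at once.
\<close>

lemma indicator_reduced_not_hears:
  assumes S: "independent_set G S" and v: "v \<in> S"
    and g: "\<And>u. u \<in> verts G \<Longrightarrow> g u \<le> indicator_broadcast S u" "g v = 0"
  shows "\<not> hears G g v w"
proof
  assume "hears G g v w"
  then have w: "w \<in> verts G" "0 < g w" "gdist G v w \<le> g w"
    by (auto simp: hears_def broadcasting_def)
  then have "w \<in> S" "gdist G v w \<le> 1"
    using g(1)[OF w(1)] by (auto simp: indicator_broadcast_def of_bool_def split: if_splits)
  then have "v = w"
    using independent_gdist_le_1[OF S v] by blast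
  then show False using w(2) g(2) by simp
qed

lemma indicator_irredundant:
  assumes S: "independent_set G S"
  shows "irredundant G (indicator_broadcast S)"
  unfolding irredundant_def
proof
  let ?f = "indicator_broadcast S"
  have sub: "S \<subseteq> verts G" using S by (simp add: independent_set_def)
  fix v assume "v \<in> broadcasting G ?f"
  then have v: "v \<in> S" using broadcasting_indicator[OF sub] by simp
  then have "\<not> hears G (?f(v := ?f v - 1)) v w" for w
    using sub by (intro indicator_reduced_not_hears[OF S]) (auto simp: indicator_broadcast_def)
  then have "v \<in> private_boundary G ?f v"
    using v sub by (auto simp: private_boundary_def nbhd_def)
  then show "private_boundary G ?f v \<noteq> {}" by blast
qed

text \<open>A vertex outside \<open>S\<close> without a neighbour in \<open>S\<close> could be added
  to \<open>S\<close>, against maximality; hence domination. A smaller broadcast vanishes at some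
  vertex of \<open>S\<close>, which then hears nothing.\<close>

lemma indicator_minimal_dominating:
  assumes S: "independent_set G S" and max: "card S = independence_number G"
  shows "minimal_dominating G (indicator_broadcast S)"
proof -
  let ?f = "indicator_broadcast S"
  have sub: "S \<subseteq> verts G" and fin: "finite S"
    using S by (auto simp: independent_set_def intro: finite_subset)
  note B = broadcasting_indicator[OF sub]
  have "dominating G ?f"
    unfolding dominating_def
  proof
    fix u assume u: "u \<in> verts G"
    have "\<exists>v\<in>S. gdist G u v \<le> 1"
    proof (cases "u \<in> S")
      case True
      then show ?thesis using u by force
    next
      case False
      then have "\<not> independent_set G (insert u S)"
        using card_le_independence_number[of "insert u S"] max fin by auto
      then obtain v where "v \<in> S" "u \<rightarrow> v"
        using S u adj_not_same[of u] arcs_ends_symmetric[OF sym_arcs]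
        by (auto simp: independent_set_def)
      then show ?thesis using gdist_adj_le_1 by blast
    qed
    then show "\<exists>v\<in>broadcasting G ?f. hears G ?f u v"
      unfolding hears_def B using sub by (auto simp: indicator_broadcast_def)
  qed
  moreover have "\<not> dominating G g"
    if g: "g \<in> broadcasts G" "g \<noteq> ?f" "\<forall>v\<in>verts G. g v \<le> ?f v" for g
  proof -
    \<comment> \<open>By extensionality, distinct broadcasts differ at a vertex of the
      graph.\<close>
    obtain v where v: "v \<in> verts G" "g v \<noteq> ?f v"
      using g(1,2) indicator_broadcast_in_broadcasts unfolding broadcasts_def
      by (metis (no_types, lifting) PiE_ext mem_Collect_eq)
    then have "g v < ?f v"
      using g(3) by (simp add: order.strict_iff_order)
    then have "v \<in> S" "g v = 0"
      by (auto simp: indicator_broadcast_def of_bool_def v(1) split: if_splits)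
    then have "\<not> hears G g v w" for w
      using g(3) by (intro indicator_reduced_not_hears[OF S]) auto
    then show ?thesis
      using v(1) by (auto simp: dominating_def)
  qed
  ultimately show ?thesis
    by (auto simp: minimal_dominating_def)
qed

section \<open>Equality of the maxima\<close>

lemma finite_broadcasts: "finite (broadcasts G)"
  by (rule finite_subset[of _ "verts G \<rightarrow>\<^sub>E {0..diam G}"]) (auto simp: broadcasts_def intro: finite_PiE)

text \<open>Handles the three parameters at once: \<open>P\<close> is any property between
  bn-independence and being the indicator of a maximum independent set, so both bounds apply to
  it.\<close>

lemma Max_weight_eq_independence_number:
  assumes bn: "\<And>f. f \<in> broadcasts G \<Longrightarrow> P f \<Longrightarrow> bn_independent G f"
    and P: "\<And>S. independent_set G S \<Longrightarrow> card S = independence_number G \<Longrightarrow> P (indicator_broadcast S)"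
  shows "Max (weight G ` {f \<in> broadcasts G. P f}) = independence_number G"
proof (rule Max_eqI)
  show "finite (weight G ` {f \<in> broadcasts G. P f})"
    using finite_broadcasts by simp
  show "w \<le> independence_number G" if "w \<in> weight G ` {f \<in> broadcasts G. P f}" for w
    using that bn bn_independent_weight_le by blast
  have "independent_set G {}"
    by (simp add: independent_set_def)
  then have "independence_number G \<in> card ` {S. independent_set G S}"
    unfolding independence_number_def using finite_independent_sets by (intro Max_in) auto
  then obtain S where S: "independent_set G S" "card S = independence_number G"
    by auto
  have "weight G (indicator_broadcast S) = card (verts G \<inter> S)"
    by (simp add: weight_def indicator_broadcast_def Int_def)
  also have "\<dots> = card S"
    using S(1) by (simp add: independent_set_def Int_absorb1)
  finally show "independence_number G \<in> weight G ` {f \<in> broadcasts G. P f}"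
    using P[OF S] S(2) indicator_broadcast_in_broadcasts by force
qed

end

theorem theorem4p1:
  fixes G :: "('a, 'b) pre_digraph"
  assumes "Digraph.graph G"
    and "k_connected 2 G"
    and "bipartite G"
  shows "alpha_bn G = alpha_bnr G \<and> alpha_bnr G = alpha_bnd G \<and>
         alpha_bnd G = independence_number G"
proof -
  interpret two_connected_bipartite G
    using assms by (simp add: two_connected_bipartite_def two_connected_bipartite_axioms_def)
  have "alpha_bn G = independence_number G"
    unfolding alpha_bn_def
    by (rule Max_weight_eq_independence_number) (auto intro: indicator_bn_independent)
  moreover have "alpha_bnr G = independence_number G"
    unfolding alpha_bnr_def bnr_independent_def
    by (rule Max_weight_eq_independence_number)
      (auto intro: indicator_bn_independent indicator_irredundant)
  moreover have "alpha_bnd G = independence_number G"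
    unfolding alpha_bnd_def bnd_independent_def
    by (rule Max_weight_eq_independence_number)
      (auto intro: indicator_bn_independent indicator_minimal_dominating)
  ultimately show ?thesis by simp
qed

end
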